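(* Let $K$ be a compact Hausdorff space with an isolated point and let $X$ be a Banach space. Then: (i) If $C(K,X)$ has $BSCSP$ (respectively $BHP$, $BDP$), then $X$ has $BSCSP$ (respectively $BHP$, $BDP$). (ii) If $X^*$ has $w^*$-$BHP$, then $C(K,X)^*$ has $w^*$-$BHP$.
   Context: All Banach spaces are real and nontrivial ($\neq \{0\}$). $C(K,X)$ is the space of continuous $X$-valued functions on $K$ with the supremum norm. $B_X$ is the closed unit ball of $X$. Slices: for a bounded set $C \subseteq X$, $f \in X^*$ with $\|f\| = 1$, and $\alpha > 0$, the set $S(C,f,\alpha) = \{x \in C : f(x) > \sup f(C) - \alpha\}$ is an open slice of $C$. A convex combination of slices of $B_X$ is a set $\sum_{i=1}^n \lambda_i S_i = \{\sum_{i=1}^n \lambda_i x_i : x_i \in S_i\}$ with $n \in \mathbb{N}$, each $S_i$ a slice of $B_X$, $\lambda_i > 0$, $\sum_{i=1}^n \lambda_i = 1$. A Banach space $X$ has - $BDP$ (ball dentable property) if for every $\varepsilon > 0$ there is a slice of $B_X$ of diameter less than $\varepsilon$; - $BHP$ (ball huskable property) if for every $\varepsilon > 0$ there is a nonempty relatively weakly open subset of $B_X$ of diameter less than $\varepsilon$; - $BSCSP$ (ball small combination of slices property) if for every $\varepsilon > 0$ there is a convex combination of slices of $B_X$ of diameter less than $\varepsilon$. A dual space $X^*$ has $w^*$-$BHP$ if for every $\varepsilon > 0$ there is a nonempty relatively $w^*$-open subset (for $\sigma(X^*,X)$) of $B_{X^*}$ of diameter less than $\varepsilon$. *)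

theory Defs
  imports "HOL-Analysis.Analysis"
begin

text \<open>
  A space is given by its type: \<open>BDP TYPE('a)\<close> says that the normed space \<open>'a\<close> has the ball
  dentable property, and so on. The dual of \<open>'a\<close> is \<open>'a \<Rightarrow>\<^sub>L real\<close> with the operator norm.
  For a compact Hausdorff space \<open>'k\<close>, the space \<open>C(K,X)\<close> is the type \<open>'k \<Rightarrow>\<^sub>C 'x\<close> of bounded
  continuous functions with the supremum norm; boundedness is automatic, \<open>'k\<close> being compact.
  The definitions are made for \<open>real_normed_vector\<close> rather than \<open>banach\<close>, because the library
  registers the completeness of \<open>'k \<Rightarrow>\<^sub>C 'x\<close> as a class instance only for metric \<open>'k\<close>.
\<close>

definition slice :: "'a::real_normed_vector set \<Rightarrow> ('a \<Rightarrow>\<^sub>L real) \<Rightarrow> real \<Rightarrow> 'a set" where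
  "slice C f \<alpha> = {x \<in> C. blinfun_apply f x > Sup (blinfun_apply f ` C) - \<alpha>}"

definition slice_of_ball :: "'a::real_normed_vector set \<Rightarrow> bool" where
  "slice_of_ball S \<longleftrightarrow> (\<exists>f \<alpha>. norm f = 1 \<and> \<alpha> > 0 \<and> S = slice (cball 0 1) f \<alpha>)"

definition convex_combination_of_slices :: "'a::real_normed_vector set \<Rightarrow> bool" where
  "convex_combination_of_slices C \<longleftrightarrow>
     (\<exists>(n::nat) (a::nat \<Rightarrow> real) (S::nat \<Rightarrow> 'a set).
        n \<ge> 1 \<and> (\<forall>i\<in>{1..n}. a i > 0 \<and> slice_of_ball (S i)) \<and> (\<Sum>i=1..n. a i) = 1 \<and>
        C = {(\<Sum>i=1..n. a i *\<^sub>R x i) | x. \<forall>i\<in>{1..n}. x i \<in> S i})"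

text \<open>
  The initial topology for the family of all continuous linear functionals: the function space
  \<open>('a \<Rightarrow>\<^sub>L real) \<Rightarrow> real\<close> carries the product topology.
\<close>

definition weak_topology :: "'a::real_normed_vector topology" where
  "weak_topology = pullback_topology UNIV (\<lambda>x (f::'a \<Rightarrow>\<^sub>L real). blinfun_apply f x) euclidean"

text \<open>
  On functionals, the strong operator topology is the topology of pointwise convergence,
  that is, \<open>\<sigma>(X\<^sup>*, X)\<close>.
\<close>

abbreviation weak_star_topology :: "('a::real_normed_vector \<Rightarrow>\<^sub>L real) topology" where
  "weak_star_topology \<equiv> strong_operator_topology"

definition BDP :: "'a::real_normed_vector itself \<Rightarrow> bool" where
  "BDP _ \<longleftrightarrow> (\<forall>\<epsilon>>0. \<exists>S::'a set. slice_of_ball S \<and> diameter S < \<epsilon>)"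

definition BHP :: "'a::real_normed_vector itself \<Rightarrow> bool" where
  "BHP _ \<longleftrightarrow> (\<forall>\<epsilon>>0. \<exists>W::'a set. openin (subtopology weak_topology (cball 0 1)) W \<and>
                W \<noteq> {} \<and> diameter W < \<epsilon>)"

definition BSCSP :: "'a::real_normed_vector itself \<Rightarrow> bool" where
  "BSCSP _ \<longleftrightarrow> (\<forall>\<epsilon>>0. \<exists>C::'a set. convex_combination_of_slices C \<and> diameter C < \<epsilon>)"

text \<open>The argument is the predual: \<open>dual_wstar_BHP TYPE('a)\<close> says that \<open>'a \<Rightarrow>\<^sub>L real\<close> has \<open>w\<^sup>*\<close>-BHP.\<close>

definition dual_wstar_BHP :: "'a::real_normed_vector itself \<Rightarrow> bool" where
  "dual_wstar_BHP _ \<longleftrightarrow>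
     (\<forall>\<epsilon>>0. \<exists>W::('a \<Rightarrow>\<^sub>L real) set. openin (subtopology weak_star_topology (cball 0 1)) W \<and>
        W \<noteq> {} \<and> diameter W < \<epsilon>)"

end

theory Submission
  imports Defs
begin

text \<open>
  Extension by zero from an isolated point \<open>k\<^sub>0\<close> is continuous, so \<open>C(K,X)\<close> is isometric to
  \<open>X \<oplus>\<^sub>\<infinity> Y\<close>, where \<open>Y\<close> consists of the functions that vanish at \<open>k\<^sub>0\<close>. Everything follows from this
  decomposition \<open>Z = X \<oplus>\<^sub>\<infinity> Y\<close>.

  For the three properties that pass from \<open>Z\<close> to \<open>X\<close>, fix the \<open>Y\<close>-component and let the
  \<open>X\<close>-component vary. As the unit ball of \<open>Z\<close> is \<open>B\<^sub>X \<times> B\<^sub>Y\<close>, a section of a small subset of \<open>B\<^sub>Z\<close> is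
  a subset of \<open>B\<^sub>X\<close> that embeds isometrically, up to a translation, into it. The section of a
  relatively weakly open set is relatively weakly open, and every slice has a section that
  contains a slice of \<open>B\<^sub>X\<close> (\<open>slice_contains_translated_slice\<close>); the latter applies term by term to
  convex combinations.

  For the dual property, \<open>Z\<^sup>* = X\<^sup>* \<oplus>\<^sub>1 Y\<^sup>*\<close>. A functional in \<open>B\<close>, the unit ball of \<open>Z\<^sup>*\<close>, whose
  \<open>X\<^sup>*\<close>-component has norm above \<open>1 - \<delta>\<close> has a \<open>Y\<^sup>*\<close>-component of norm at most \<open>\<delta>\<close>. Hence a small
  relatively \<open>w\<^sup>*\<close>-open subset of the unit ball of \<open>X\<^sup>*\<close> can be pulled back to a small subset of \<open>B\<close>
  once it contains a functional of norm close to one. A given small set may lie deep inside the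
  ball, as happens for finite-dimensional \<open>X\<close>; but then a magnified copy of it, placed around
  a functional on the sphere, is still small (\<open>dual_wstar_BHP_near_sphere\<close>).

  Both parts need a functional of norm one on \<open>X\<close>: if the functional of a slice of \<open>B\<^sub>Z\<close> vanishes on
  \<open>X\<close>, its section is all of \<open>B\<^sub>X\<close>, and a slice has to be found in there. It comes from the
  Hahn--Banach theorem.
\<close>

section \<open>Norm-one functionals\<close>

definition sublinear :: "('a::real_vector \<Rightarrow> real) \<Rightarrow> bool" where
  "sublinear p \<longleftrightarrow> (\<forall>x y. p (x + y) \<le> p x + p y) \<and> (\<forall>c\<ge>0. \<forall>x. p (c *\<^sub>R x) \<le> c * p x)"

lemma sublinear_add: "sublinear p \<Longrightarrow> p (x + y) \<le> p x + p y"
  by (simp add: sublinear_def)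

lemma sublinear_zero:
  assumes "sublinear p"
  shows "p 0 = 0"
proof (rule antisym)
  have "p (0 *\<^sub>R 0) \<le> 0 * p 0" using assms unfolding sublinear_def by blast
  then show "p 0 \<le> 0" by simp
  show "0 \<le> p 0" using sublinear_add[OF assms, of 0 0] by simp
qed

lemma sublinear_scaleR:
  assumes "sublinear p" "c \<ge> 0"
  shows "p (c *\<^sub>R x) = c * p x"
proof (cases "c = 0")
  case True
  then show ?thesis using sublinear_zero[OF assms(1)] by simp
next
  case False
  then have "c > 0" using assms(2) by simp
  have le: "p (d *\<^sub>R y) \<le> d * p y" if "d \<ge> 0" for d y
    using assms(1) that by (simp add: sublinear_def)
  have "p x \<le> (1 / c) * p (c *\<^sub>R x)"
    using le[of "1 / c" "c *\<^sub>R x"] \<open>c > 0\<close> by simp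
  then have "c * p x \<le> p (c *\<^sub>R x)"
    using \<open>c > 0\<close> by (simp add: field_simps)
  then show ?thesis using le[of c x] assms(2) by simp
qed

lemma sublinear_minus: "sublinear p \<Longrightarrow> - p (- x) \<le> p x"
  using sublinear_add[of p x "- x"] sublinear_zero[of p] by simp

text \<open>
  Sublinearity survives an infimum over a family that is, loosely, directed downwards. This covers
  both infima in the proof of the Hahn--Banach theorem: over a chain of sublinear functionals, and
  over the functions \<open>\<lambda>x. p (x + t *\<^sub>R a) - t * p a\<close> with \<open>t \<ge> 0\<close>, which are not themselves sublinear.
\<close>

lemma sublinear_INF:
  fixes p :: "'i \<Rightarrow> 'a::real_vector \<Rightarrow> real"
  assumes "I \<noteq> {}"
    and bdd: "\<And>x. bdd_below ((\<lambda>i. p i x) ` I)"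
    and add: "\<And>i j x y. i \<in> I \<Longrightarrow> j \<in> I \<Longrightarrow> \<exists>k\<in>I. p k (x + y) \<le> p i x + p j y"
    and scale: "\<And>i c x. i \<in> I \<Longrightarrow> c \<ge> 0 \<Longrightarrow> \<exists>k\<in>I. p k (c *\<^sub>R x) \<le> c * p i x"
  shows "sublinear (\<lambda>x. INF i\<in>I. p i x)"
proof -
  let ?q = "\<lambda>x. INF i\<in>I. p i x"
  have low: "?q x \<le> p i x" if "i \<in> I" for i x
    using that bdd by (rule cINF_lower[rotated])
  have "?q (x + y) \<le> ?q x + ?q y" for x y
  proof -
    have "?q (x + y) - p j y \<le> ?q x" if j: "j \<in> I" for j
    proof (rule cINF_greatest[OF \<open>I \<noteq> {}\<close>])
      fix i assume "i \<in> I"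
      then obtain k where "k \<in> I" "p k (x + y) \<le> p i x + p j y" using add j by blast
      then show "?q (x + y) - p j y \<le> p i x" using low[of k "x + y"] by linarith
    qed
    then have "?q (x + y) - ?q x \<le> ?q y"
      by (intro cINF_greatest[OF \<open>I \<noteq> {}\<close>]) (simp add: algebra_simps)
    then show ?thesis by simp
  qed
  moreover have "?q (c *\<^sub>R x) \<le> c * ?q x" if "c \<ge> 0" for c x
  proof -
    have le: "?q (c *\<^sub>R x) \<le> c * p i x" if i: "i \<in> I" for i
    proof -
      obtain k where "k \<in> I" "p k (c *\<^sub>R x) \<le> c * p i x" using scale i \<open>c \<ge> 0\<close> by blast
      then show ?thesis using low[of k "c *\<^sub>R x"] by linarith
    qed
    show ?thesis
    proof (cases "c = 0")
      case True
      then show ?thesis using le \<open>I \<noteq> {}\<close> by auto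
    next
      case False
      then have "c > 0" using that by simp
      have "?q (c *\<^sub>R x) / c \<le> ?q x"
        using le \<open>c > 0\<close> by (intro cINF_greatest[OF \<open>I \<noteq> {}\<close>]) (simp add: field_simps)
      then show ?thesis using \<open>c > 0\<close> by (simp add: field_simps)
    qed
  qed
  ultimately show ?thesis unfolding sublinear_def by blast
qed

text \<open>
  The infimum \<open>q\<close> of the functions \<open>\<lambda>x. p (x + t *\<^sub>R a) - t * p a\<close> over \<open>t \<ge> 0\<close> serves two ends in the proof of
  the Hahn--Banach theorem. The parameter \<open>t = 1\<close> at the point \<open>- a\<close> gives \<open>q (- a) \<le> - p a\<close>, so each linear
  functional below \<open>q\<close> agrees with \<open>p\<close> at \<open>a\<close>; and if \<open>p\<close> is minimal then \<open>q = p\<close>, so that \<open>p\<close> is additive.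
\<close>

lemma sublinear_below_linear_at:
  fixes p :: "'a::real_vector \<Rightarrow> real"
  assumes p: "sublinear p"
  obtains q where "sublinear q" "\<And>x. q x \<le> p x" "\<And>x. q x \<le> p (x + a) - p a"
proof -
  let ?p = "\<lambda>t x. p (x + t *\<^sub>R a) - t * p a"
  define q where "q = (\<lambda>x. INF t\<in>{0..}. ?p t x)"
  have bdd: "bdd_below ((\<lambda>t. ?p t x) ` {0..})" for x
  proof (rule bdd_belowI2)
    fix t :: real assume "t \<in> {0..}"
    then have "t * p a = p (t *\<^sub>R a)" using sublinear_scaleR[OF p] by simp
    also have "\<dots> = p ((x + t *\<^sub>R a) + (- x))" by simp
    also have "\<dots> \<le> p (x + t *\<^sub>R a) + p (- x)" by (rule sublinear_add[OF p])
    finally show "- p (- x) \<le> ?p t x" by simp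
  qed
  have "sublinear q"
    unfolding q_def
  proof (rule sublinear_INF)
    show "bdd_below ((\<lambda>t. ?p t x) ` {0..})" for x by (rule bdd)
  next
    fix s t :: real and x y :: 'a assume "s \<in> {0..}" "t \<in> {0..}"
    moreover have "p ((x + s *\<^sub>R a) + (y + t *\<^sub>R a)) \<le> p (x + s *\<^sub>R a) + p (y + t *\<^sub>R a)"
      by (rule sublinear_add[OF p])
    ultimately show "\<exists>k\<in>{0..}. ?p k (x + y) \<le> ?p s x + ?p t y"
      by (intro bexI[of _ "s + t"]) (auto simp: algebra_simps)
  next
    fix t c :: real and x :: 'a assume "t \<in> {0..}" "c \<ge> 0"
    moreover have "p (c *\<^sub>R (x + t *\<^sub>R a)) = c * p (x + t *\<^sub>R a)"
      by (rule sublinear_scaleR[OF p \<open>c \<ge> 0\<close>])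
    ultimately show "\<exists>k\<in>{0..}. ?p k (c *\<^sub>R x) \<le> c * ?p t x"
      by (intro bexI[of _ "c * t"]) (auto simp: algebra_simps)
  qed auto
  moreover have "q x \<le> ?p t x" if "t \<ge> 0" for t x
    unfolding q_def using that by (intro cINF_lower bdd) auto
  from this[of 0] this[of 1] have "q x \<le> p x" "q x \<le> p (x + a) - p a" for x by auto
  ultimately show thesis using that by blast
qed

text \<open>
  Zorn's lemma for the reversed pointwise order. A chain below \<open>p\<close> has a pointwise infimum because a
  sublinear \<open>q \<le> p\<close> satisfies \<open>q x \<ge> - q (- x) \<ge> - p (- x)\<close>.
\<close>

lemma sublinear_minimal_below:
  fixes p :: "'a::real_vector \<Rightarrow> real"
  assumes p: "sublinear p"
  obtains m where "sublinear m" "m \<le> p" "\<And>q. sublinear q \<Longrightarrow> q \<le> m \<Longrightarrow> q = m"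
proof -
  define A where "A = {q. sublinear q \<and> q \<le> p}"
  have "\<exists>m\<in>A. \<forall>a\<in>A. m \<ge> a \<longrightarrow> a = m"
  proof (rule predicate_Zorn)
    show "partial_order_on A (relation_of (\<ge>) A)"
      by (rule partial_order_on_relation_ofI) auto
  next
    fix C assume C: "C \<in> Chains (relation_of (\<ge>) A)"
    then have CA: "C \<subseteq> A" and total: "\<And>q r. q \<in> C \<Longrightarrow> r \<in> C \<Longrightarrow> q \<le> r \<or> r \<le> q"
      by (auto simp: Chains_def relation_of_def)
    show "\<exists>u\<in>A. \<forall>a\<in>C. a \<ge> u"
    proof (cases "C = {}")
      case True
      then show ?thesis using p by (auto simp: A_def)
    next
      case False
      let ?u = "\<lambda>x. INF q\<in>C. q x"
      have bdd: "bdd_below ((\<lambda>q. q x) ` C)" for x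
      proof (rule bdd_belowI2)
        fix q assume "q \<in> C"
        then have "sublinear q" "q (- x) \<le> p (- x)" using CA by (auto simp: A_def le_fun_def)
        then show "- p (- x) \<le> q x" using sublinear_minus[of q x] by linarith
      qed
      have low: "?u \<le> q" if "q \<in> C" for q
        unfolding le_fun_def using that by (auto intro: cINF_lower bdd)
      have "sublinear ?u"
      proof (rule sublinear_INF[OF False bdd])
        fix q r and x y :: 'a assume qr: "q \<in> C" "r \<in> C"
        then obtain k where "k \<in> C" "k \<le> q" "k \<le> r" using total by (metis order_refl)
        moreover have "k (x + y) \<le> k x + k y"
          using \<open>k \<in> C\<close> CA by (auto simp: A_def intro: sublinear_add)
        ultimately show "\<exists>k\<in>C. k (x + y) \<le> q x + r y"
          by (intro bexI[of _ k]) (auto simp: le_fun_def intro: order_trans[OF _ add_mono])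
      next
        fix q and c :: real and x :: 'a assume "q \<in> C" "c \<ge> 0"
        then show "\<exists>k\<in>C. k (c *\<^sub>R x) \<le> c * q x"
          using CA by (intro bexI[of _ q]) (auto simp: A_def sublinear_scaleR)
      qed
      moreover have "?u \<le> p"
      proof -
        obtain q where "q \<in> C" using False by blast
        then have "?u \<le> q" "q \<le> p" using low CA by (auto simp: A_def)
        then show ?thesis by (rule order_trans)
      qed
      ultimately show ?thesis using low by (auto simp: A_def)
    qed
  qed
  then obtain m where "m \<in> A" "\<And>a. a \<in> A \<Longrightarrow> a \<le> m \<Longrightarrow> a = m" by blast
  then show thesis
    using that[of m] by (auto simp: A_def intro: order_trans)
qed

lemma sublinear_minimal_imp_linear:
  assumes m: "sublinear m" and minimal: "\<And>q. sublinear q \<Longrightarrow> q \<le> m \<Longrightarrow> q = m"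
  shows "linear m"
proof -
  have add: "m (x + y) = m x + m y" for x y
  proof -
    obtain q where q: "sublinear q" "\<And>x. q x \<le> m x" "\<And>x. q x \<le> m (x + y) - m y"
      using sublinear_below_linear_at[OF m] by metis
    then have "q = m" by (intro minimal) (auto simp: le_fun_def)
    then show ?thesis using q(3)[of x] sublinear_add[OF m, of x y] by simp
  qed
  have minus: "m (- x) = - m x" for x
    using add[of x "- x"] sublinear_zero[OF m] by simp
  have "m (c *\<^sub>R x) = c *\<^sub>R m x" for c x
  proof (cases "c \<ge> 0")
    case True
    then show ?thesis using sublinear_scaleR[OF m] by simp
  next
    case False
    then show ?thesis using sublinear_scaleR[OF m, of "- c" x] minus[of "c *\<^sub>R x"] by simp
  qed
  with add show ?thesis by (rule linearI)
qed

text \<open>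
  The Hahn--Banach theorem in the form of a supporting functional: a minimal sublinear functional
  below \<open>p\<close> is linear, and starting the descent from a \<open>q \<le> p\<close> with \<open>q (- a) \<le> - p a\<close> keeps its value
  at \<open>a\<close> from dropping below \<open>p a\<close>.
\<close>

lemma hahn_banach_sublinear:
  fixes p :: "'a::real_vector \<Rightarrow> real"
  assumes p: "sublinear p"
  obtains f where "linear f" "\<And>x. f x \<le> p x" "f a = p a"
proof -
  obtain q where q: "sublinear q" "\<And>x. q x \<le> p x" "\<And>x. q x \<le> p (x + a) - p a"
    using sublinear_below_linear_at[OF p] by metis
  obtain f where f: "sublinear f" "f \<le> q" "\<And>r. sublinear r \<Longrightarrow> r \<le> f \<Longrightarrow> r = f"
    using sublinear_minimal_below[OF q(1)] by metis
  have lin: "linear f" by (rule sublinear_minimal_imp_linear[OF f(1,3)])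
  have fq: "f x \<le> q x" for x using f(2) by (simp add: le_fun_def)
  have le: "f x \<le> p x" for x using fq[of x] q(2)[of x] by simp
  have "f (- a) \<le> - p a"
    using fq[of "- a"] q(3)[of "- a"] sublinear_zero[OF p] by simp
  then have "p a \<le> f a" using linear_neg[OF lin, of a] by simp
  with lin le show thesis using that[of f] by (simp add: order_antisym)
qed

lemma exists_norm_one_functional:
  assumes "\<exists>x::'a::real_normed_vector. x \<noteq> 0"
  obtains h :: "'a::real_normed_vector \<Rightarrow>\<^sub>L real" where "norm h = 1"
proof -
  obtain a :: 'a where "a \<noteq> 0" using assms by blast
  have "sublinear (norm :: 'a \<Rightarrow> real)" by (simp add: sublinear_def norm_triangle_ineq)
  then obtain f where f: "linear f" "\<And>x::'a. f x \<le> norm x" "f a = norm a"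
    using hahn_banach_sublinear by metis
  have abs: "\<bar>f x\<bar> \<le> norm x" for x
    using f(2)[of x] f(2)[of "- x"] linear_neg[OF f(1), of x] by simp
  then have bl: "bounded_linear f"
    using f(1) by (auto simp: bounded_linear_def bounded_linear_axioms_def intro!: exI[of _ 1])
  define h where "h = Blinfun f"
  have hf: "blinfun_apply h x = f x" for x
    unfolding h_def by (simp add: bounded_linear_Blinfun_apply[OF bl])
  have "norm h \<le> 1" using abs by (intro norm_blinfun_bound) (auto simp: hf)
  moreover have "norm a \<le> norm h * norm a"
    using norm_blinfun[of h a] by (simp add: hf f(3))
  then have "1 \<le> norm h" using \<open>a \<noteq> 0\<close> by simp
  ultimately show thesis using that[of h] by simp
qed

lemma functional_exceeds_on_ball:
  fixes f :: "'a::real_normed_vector \<Rightarrow>\<^sub>L real"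
  assumes "c < norm f"
  obtains x where "norm x \<le> 1" "blinfun_apply f x > c"
proof -
  have "\<exists>x. norm x \<le> 1 \<and> blinfun_apply f x > c"
  proof (rule ccontr)
    assume "\<not> ?thesis"
    then have le: "blinfun_apply f x \<le> c" if "norm x \<le> 1" for x using that by force
    have "c \<ge> 0" using le[of 0] by simp
    moreover have "norm (blinfun_apply f x) \<le> c * norm x" for x
    proof (cases "x = 0")
      case False
      then have "blinfun_apply f (sgn x) \<le> c" "blinfun_apply f (- sgn x) \<le> c"
        by (auto intro!: le simp: norm_sgn)
      with False show ?thesis
        by (simp add: sgn_div_norm blinfun.scaleR_right blinfun.minus_right field_simps abs_le_iff)
    qed simp
    ultimately have "norm f \<le> c" by (rule norm_blinfun_bound)
    with assms show False by simp
  qed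
  then show thesis using that by blast
qed

section \<open>Weak and weak-star continuity\<close>

lemma continuous_map_weak_topology_iff:
  fixes g :: "'a \<Rightarrow> 'b::real_normed_vector"
  shows "continuous_map T weak_topology g \<longleftrightarrow>
     (\<forall>f :: 'b \<Rightarrow>\<^sub>L real. continuous_map T euclidean (\<lambda>y. blinfun_apply f (g y)))"
proof
  assume g: "continuous_map T weak_topology g"
  show "\<forall>f :: 'b \<Rightarrow>\<^sub>L real. continuous_map T euclidean (\<lambda>y. blinfun_apply f (g y))"
  proof
    fix f :: "'b \<Rightarrow>\<^sub>L real"
    have "continuous_map weak_topology euclidean ((\<lambda>h. h f) \<circ> (\<lambda>x f. blinfun_apply f x))"
      unfolding weak_topology_def by (rule continuous_map_pullback) simp
    from continuous_map_compose[OF g this]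
    show "continuous_map T euclidean (\<lambda>y. blinfun_apply f (g y))" by (simp add: o_def)
  qed
next
  assume "\<forall>f :: 'b \<Rightarrow>\<^sub>L real. continuous_map T euclidean (\<lambda>y. blinfun_apply f (g y))"
  then have "continuous_map T euclidean (\<lambda>y (f :: 'b \<Rightarrow>\<^sub>L real). blinfun_apply f (g y))"
    unfolding euclidean_product_topology[symmetric] continuous_map_componentwise_UNIV .
  then show "continuous_map T weak_topology g"
    unfolding weak_topology_def by (intro continuous_map_pullback') (auto simp: o_def)
qed

lemma continuous_map_weak_affine:
  "continuous_map weak_topology weak_topology (\<lambda>x. blinfun_apply A x + b)"
  unfolding continuous_map_weak_topology_iff
proof
  fix f :: "'b \<Rightarrow>\<^sub>L real"
  have "continuous_map weak_topology euclidean (\<lambda>x. blinfun_apply (f o\<^sub>L A) x)"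
    using continuous_map_weak_topology_iff[THEN iffD1, OF continuous_map_id[unfolded id_def]] by blast
  then show "continuous_map weak_topology euclidean (\<lambda>x. blinfun_apply f (blinfun_apply A x + b))"
    by (simp add: blinfun.add_right continuous_map_add)
qed

lemma openin_weak_star_greater:
  "openin weak_star_topology {f. c < blinfun_apply f x}"
  using openin_continuous_map_preimage[OF strong_operator_topology_continuous_evaluation, of "{c<..}" x]
  by (simp add: strong_operator_topology_topspace)

lemma openin_preimage_UNIV:
  assumes "continuous_map S T g" "topspace S = UNIV" "openin T U"
  shows "openin S {x. g x \<in> U}"
  using openin_continuous_map_preimage[OF assms(1,3)] assms(2) by simp

lemma topspace_weak_topology: "topspace weak_topology = UNIV"
  by (simp add: weak_topology_def topspace_pullback_topology)

section \<open>The weak-star huskable property near the unit sphere\<close>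

text \<open>
  Take a relatively \<open>w\<^sup>*\<close>-open subset \<open>W\<close> of the dual ball, of diameter of order \<open>\<epsilon>\<^sup>2\<close>. If it has no
  element of norm above \<open>1 - \<epsilon>\<close>, pick \<open>f0\<close> in \<open>W\<close> and \<open>h\<close> of norm one. The map
  \<open>g \<mapsto> f0 + (\<epsilon> / 2) (g - h)\<close> sends \<open>h\<close> to \<open>f0\<close> and the ball into itself, since \<open>\<parallel>f0\<parallel> \<le> 1 - \<epsilon>\<close>
  leaves room for the displacement. So the preimage of \<open>W\<close> is a \<open>w\<^sup>*\<close>-neighbourhood of \<open>h\<close> in the
  ball, and its diameter is of order \<open>\<epsilon>\<^sup>2 / \<epsilon> = \<epsilon>\<close>.
\<close>

lemma dual_wstar_BHP_near_sphere:
  assumes BHP: "dual_wstar_BHP TYPE('a::real_normed_vector)" and ne: "\<exists>x::'a::real_normed_vector. x \<noteq> 0"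
    and "0 < \<epsilon>" "\<epsilon> \<le> 1"
  obtains U and h :: "'a::real_normed_vector \<Rightarrow>\<^sub>L real"
  where "openin weak_star_topology U" "h \<in> U" "norm h \<le> 1" "norm h > 1 - \<epsilon>"
    "\<And>f g. \<lbrakk>f \<in> U; g \<in> U; norm f \<le> 1; norm g \<le> 1\<rbrakk> \<Longrightarrow> norm (f - g) \<le> \<epsilon>"
proof -
  define \<eta> where "\<eta> = \<epsilon>\<^sup>2 / 4"
  have \<eta>: "0 < \<eta>" "\<eta> \<le> \<epsilon>"
    using assms(3,4) mult_left_le[of \<epsilon> \<epsilon>] by (auto simp: \<eta>_def power2_eq_square)
  obtain W :: "('a \<Rightarrow>\<^sub>L real) set" where
    W: "openin (subtopology weak_star_topology (cball 0 1)) W" "W \<noteq> {}" "diameter W < \<eta>"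
    using BHP \<eta>(1) unfolding dual_wstar_BHP_def by blast
  then obtain U where U: "openin weak_star_topology U" and WU: "W = U \<inter> cball 0 1"
    by (auto simp: openin_subtopology)
  have small: "norm (f - g) < \<eta>" if "f \<in> W" "g \<in> W" for f g
  proof -
    have "bounded W" unfolding WU by (rule bounded_subset[OF bounded_cball]) auto
    from diameter_bounded_bound[OF this that] show ?thesis using W(3) by (simp add: dist_norm)
  qed
  show thesis
  proof (cases "\<exists>h\<in>W. norm h > 1 - \<epsilon>")
    case True
    then obtain h where h: "h \<in> W" "norm h > 1 - \<epsilon>" by blast
    show thesis
    proof (rule that[OF U])
      show "norm (f - g) \<le> \<epsilon>" if "f \<in> U" "g \<in> U" "norm f \<le> 1" "norm g \<le> 1" for f g
        using small[of f g] that WU \<eta>(2) by simp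
    qed (use h WU in auto)
  next
    case False
    obtain f0 where f0: "f0 \<in> W" using W(2) by blast
    then have nf0: "norm f0 \<le> 1 - \<epsilon>" using False by force
    obtain h :: "'a \<Rightarrow>\<^sub>L real" where h: "norm h = 1" using exists_norm_one_functional[OF ne] by metis
    define T where "T = (\<lambda>g. f0 + (\<epsilon> / 2) *\<^sub>R (g - h))"
    define V where "V = {g. T g \<in> U}"
    have "continuous_map weak_star_topology weak_star_topology T"
      unfolding continuous_on_strong_operator_topo_iff_coordinatewise
    proof
      fix x
      show "continuous_map weak_star_topology euclidean (\<lambda>g. blinfun_apply (T g) x)"
        unfolding T_def blinfun.add_left blinfun.scaleR_left blinfun.diff_left real_scaleR_def
        by (intro continuous_map_add continuous_map_real_mult continuous_map_diff
            strong_operator_topology_continuous_evaluation continuous_map_const[THEN iffD2]) auto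
    qed
    then have V: "openin weak_star_topology V"
      unfolding V_def
      by (rule openin_preimage_UNIV) (simp_all add: strong_operator_topology_topspace U)
    have near: "norm (g - h) \<le> \<epsilon> / 2" if "g \<in> V" "norm g \<le> 1" for g
    proof -
      have "norm (g - h) \<le> 2" using norm_triangle_ineq4[of g h] that(2) h by simp
      then have "norm ((\<epsilon> / 2) *\<^sub>R (g - h)) \<le> \<epsilon>" using \<open>0 < \<epsilon>\<close> by simp
      then have "norm (T g) \<le> 1"
        unfolding T_def using norm_triangle_ineq[of f0 "(\<epsilon> / 2) *\<^sub>R (g - h)"] nf0 by linarith
      then have "T g \<in> W" using that(1) WU by (simp add: V_def)
      from small[OF this f0] have "\<epsilon> / 2 * norm (g - h) < \<epsilon> / 2 * (\<epsilon> / 2)"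
        using \<open>0 < \<epsilon>\<close> by (simp add: T_def \<eta>_def power2_eq_square)
      then show ?thesis using \<open>0 < \<epsilon>\<close> by (simp add: mult_less_cancel_left)
    qed
    show thesis
    proof (rule that[OF V])
      show "h \<in> V" using f0 WU by (simp add: V_def T_def)
      show "norm h \<le> 1" "norm h > 1 - \<epsilon>" using h \<open>0 < \<epsilon>\<close> by auto
      show "norm (f - g) \<le> \<epsilon>" if "f \<in> V" "g \<in> V" "norm f \<le> 1" "norm g \<le> 1" for f g
        using near[of f] near[of g] that norm_triangle_ineq4[of "f - h" "g - h"] by simp
    qed
  qed
qed

section \<open>Summands of a maximum-norm decomposition\<close>

lemma slice_of_ball_subset: "slice_of_ball S \<Longrightarrow> S \<subseteq> cball 0 1"
  by (auto simp: slice_of_ball_def slice_def)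

text \<open>
  The data amount to an isometric identification of \<open>Z\<close> with \<open>X \<oplus>\<^sub>\<infinity> ker R\<close>: \<open>E\<close> is the embedding of
  the first summand and \<open>R\<close> the projection onto it. The complement \<open>ker R\<close> occurs only through
  the projection \<open>Q\<close> onto it, so that it needs no type of its own and may be trivial.
\<close>

locale max_norm_summand =
  fixes E :: "'x::real_normed_vector \<Rightarrow>\<^sub>L 'z::real_normed_vector" and R :: "'z \<Rightarrow>\<^sub>L 'x"
  assumes R_E [simp]: "blinfun_apply R (blinfun_apply E x) = x"
    and norm_split: "norm z = max (norm (blinfun_apply R z))
      (norm (z - blinfun_apply E (blinfun_apply R z)))"
begin

definition Q :: "'z \<Rightarrow>\<^sub>L 'z" where
  "Q = id_blinfun - (E o\<^sub>L R)"

lemma Q_apply: "blinfun_apply Q z = z - blinfun_apply E (blinfun_apply R z)"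
  by (simp add: Q_def blinfun.diff_left)

lemma decompose: "blinfun_apply E (blinfun_apply R z) + blinfun_apply Q z = z"
  by (simp add: Q_apply)

lemma norm_E [simp]: "norm (blinfun_apply E x) = norm x"
  using norm_split[of "blinfun_apply E x"] by simp

lemma norm_R_le: "norm (blinfun_apply R z) \<le> norm z"
  using norm_split[of z] by simp

lemma norm_E_add_Q: "norm (blinfun_apply E x + blinfun_apply Q z) = max (norm x) (norm (blinfun_apply Q z))"
  using norm_split[of "blinfun_apply E x + blinfun_apply Q z"]
  by (simp add: Q_apply blinfun.add_right blinfun.diff_right)

lemma norm_Q_le: "norm (blinfun_apply Q z) \<le> norm z"
  using norm_split[of z] by (simp add: Q_apply)

lemma norm_E_add_Q_le_1:
  "norm x \<le> 1 \<Longrightarrow> norm z \<le> 1 \<Longrightarrow> norm (blinfun_apply E x + blinfun_apply Q z) \<le> 1"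
  using norm_Q_le[of z] by (simp add: norm_E_add_Q)

lemma diameter_le_of_translate:
  assumes "bounded S" and "\<And>x. x \<in> T \<Longrightarrow> blinfun_apply E x + y \<in> S"
  shows "diameter T \<le> diameter S"
proof (rule diameter_le)
  show "T \<noteq> {} \<or> 0 \<le> diameter S" using assms(1) by (simp add: diameter_ge_0)
  fix a b assume "a \<in> T" "b \<in> T"
  then have "dist (blinfun_apply E a + y) (blinfun_apply E b + y) \<le> diameter S"
    using assms by (intro diameter_bounded_bound) auto
  moreover have "norm (blinfun_apply E a - blinfun_apply E b) = norm (a - b)"
    unfolding blinfun.diff_right[symmetric] by simp
  ultimately show "norm (a - b) \<le> diameter S" by (simp add: dist_norm)
qed

text \<open>
  Choose \<open>z\<close> in the slice of \<open>f\<close> and let \<open>y\<close> be its \<open>Y\<close>-component. For \<open>x\<close> in \<open>B\<^sub>X\<close> the point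
  \<open>E x + y\<close> stays in the ball and lies in the slice as soon as \<open>f (E x)\<close> exceeds a certain bound, which
  \<open>x = R z\<close> exceeds. If \<open>f\<close> does not vanish on the first summand, these \<open>x\<close> form a slice of \<open>B\<^sub>X\<close>
  after normalization; otherwise they fill \<open>B\<^sub>X\<close>, and any slice will do.
\<close>

lemma slice_contains_translated_slice:
  assumes S: "slice_of_ball S" and ne: "\<exists>x::'x. x \<noteq> 0"
  obtains T y where "slice_of_ball T" "\<And>x. x \<in> T \<Longrightarrow> blinfun_apply E x + y \<in> S"
proof -
  obtain f \<alpha> where "\<alpha> > 0" and S_eq: "S = slice (cball 0 1) f \<alpha>"
    using S unfolding slice_of_ball_def by blast
  define c where "c = Sup (blinfun_apply f ` cball 0 1) - \<alpha>"
  have "\<exists>v\<in>blinfun_apply f ` cball 0 1. c < v"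
    by (rule less_cSupD) (use \<open>\<alpha> > 0\<close> in \<open>auto simp: c_def\<close>)
  then obtain z where z: "norm z \<le> 1" "c < blinfun_apply f z" by auto
  define y where "y = blinfun_apply Q z"
  define g where "g = f o\<^sub>L E"
  have inS: "blinfun_apply E x + y \<in> S"
    if "norm x \<le> 1" "blinfun_apply g x > c - blinfun_apply f y" for x
    using that norm_E_add_Q_le_1[OF that(1) z(1)]
    by (simp add: S_eq slice_def c_def y_def g_def blinfun.add_right)
  have "blinfun_apply f z = blinfun_apply g (blinfun_apply R z) + blinfun_apply f y"
    using arg_cong[OF decompose[of z], of "blinfun_apply f"]
    by (simp add: g_def y_def blinfun.add_right)
  then have Rz: "norm (blinfun_apply R z) \<le> 1" "blinfun_apply g (blinfun_apply R z) > c - blinfun_apply f y"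
    using norm_R_le[of z] z by auto
  show thesis
  proof (cases "g = 0")
    case True
    obtain h :: "'x \<Rightarrow>\<^sub>L real" where "norm h = 1" using exists_norm_one_functional[OF ne] by metis
    then have "slice_of_ball (slice (cball 0 1) h 1)"
      unfolding slice_of_ball_def using zero_less_one by blast
    then show thesis
      using that[of "slice (cball 0 1) h 1" y] inS Rz True by (auto simp: slice_def)
  next
    case False
    define h where "h = g /\<^sub>R norm g"
    have h: "norm h = 1" using False by (simp add: h_def)
    have gh: "blinfun_apply g x = norm g * blinfun_apply h x" for x
      using False by (simp add: h_def blinfun.scaleR_left)
    define s where "s = Sup (blinfun_apply h ` cball 0 1)"
    define d where "d = (c - blinfun_apply f y) / norm g"
    have gt: "blinfun_apply g x > c - blinfun_apply f y \<longleftrightarrow> blinfun_apply h x > d" for x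
      unfolding gh d_def using False by (simp add: divide_less_eq mult.commute)
    have "bdd_above (blinfun_apply h ` cball 0 1)"
    proof (rule bdd_aboveI2)
      fix x :: 'x assume "x \<in> cball 0 1"
      then show "blinfun_apply h x \<le> 1" using norm_blinfun[of h x] h by simp
    qed
    then have "blinfun_apply h (blinfun_apply R z) \<le> s"
      unfolding s_def using Rz(1) by (intro cSUP_upper) auto
    moreover have "d < blinfun_apply h (blinfun_apply R z)" using Rz(2) gt by blast
    ultimately have "s - d > 0" by simp
    then have "slice_of_ball (slice (cball 0 1) h (s - d))"
      unfolding slice_of_ball_def using h by blast
    moreover have "blinfun_apply E x + y \<in> S" if "x \<in> slice (cball 0 1) h (s - d)" for x
      using that gt by (intro inS) (auto simp: slice_def s_def)
    ultimately show thesis using that by blast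
  qed
qed

lemma BDP_summand:
  assumes "BDP TYPE('z)" and ne: "\<exists>x::'x. x \<noteq> 0"
  shows "BDP TYPE('x)"
  unfolding BDP_def
proof (intro allI impI)
  fix \<epsilon> :: real assume "\<epsilon> > 0"
  then obtain S :: "'z set" where S: "slice_of_ball S" "diameter S < \<epsilon>"
    using assms(1) unfolding BDP_def by blast
  obtain T y where T: "slice_of_ball T" "\<And>x. x \<in> T \<Longrightarrow> blinfun_apply E x + y \<in> S"
    using slice_contains_translated_slice[OF S(1) ne] by metis
  have "bounded S" using slice_of_ball_subset[OF S(1)] by (rule bounded_subset[OF bounded_cball])
  then have "diameter T \<le> diameter S" using T(2) by (rule diameter_le_of_translate)
  then have "diameter T < \<epsilon>" using S(2) by simp
  with T(1) show "\<exists>S::'x set. slice_of_ball S \<and> diameter S < \<epsilon>" by blast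
qed

lemma BSCSP_summand:
  assumes "BSCSP TYPE('z)" and ne: "\<exists>x::'x. x \<noteq> 0"
  shows "BSCSP TYPE('x)"
  unfolding BSCSP_def
proof (intro allI impI)
  fix \<epsilon> :: real assume "\<epsilon> > 0"
  then obtain C :: "'z set" where C: "convex_combination_of_slices C" "diameter C < \<epsilon>"
    using assms(1) unfolding BSCSP_def by blast
  then obtain n :: nat and a S where n: "n \<ge> 1"
    and S: "\<And>i. i \<in> {1..n} \<Longrightarrow> a i > 0 \<and> slice_of_ball (S i)" and a1: "(\<Sum>i=1..n. a i) = 1"
    and C_eq: "C = {(\<Sum>i=1..n. a i *\<^sub>R z i) | z. \<forall>i\<in>{1..n}. z i \<in> S i}"
    unfolding convex_combination_of_slices_def by (elim exE conjE) blast
  have "\<exists>T y. slice_of_ball T \<and> (\<forall>x\<in>T. blinfun_apply E x + y \<in> S i)" if "i \<in> {1..n}" for i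
  proof -
    have "slice_of_ball (S i)" using S that by blast
    then obtain T y where "slice_of_ball T" "\<And>x. x \<in> T \<Longrightarrow> blinfun_apply E x + y \<in> S i"
      using slice_contains_translated_slice[OF _ ne] by metis
    then show ?thesis by blast
  qed
  then obtain T y where T: "\<And>i. i \<in> {1..n} \<Longrightarrow> slice_of_ball (T i)"
    and TS: "\<And>i x. i \<in> {1..n} \<Longrightarrow> x \<in> T i \<Longrightarrow> blinfun_apply E x + y i \<in> S i"
    by (metis (no_types))
  define D where "D = {(\<Sum>i=1..n. a i *\<^sub>R x i) | x. \<forall>i\<in>{1..n}. x i \<in> T i}"
  have "C \<subseteq> cball 0 1"
  proof
    fix v assume "v \<in> C"
    then obtain z where v: "v = (\<Sum>i=1..n. a i *\<^sub>R z i)" and z: "\<forall>i\<in>{1..n}. z i \<in> S i"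
      unfolding C_eq by blast
    show "v \<in> cball 0 1"
      unfolding v
    proof (rule convex_sum[OF _ convex_cball a1])
      fix i assume "i \<in> {1..n}"
      then show "0 \<le> a i" "z i \<in> cball 0 1"
        using S[of i] z slice_of_ball_subset[of "S i"] by (blast intro: less_imp_le)+
    qed simp
  qed
  then have "bounded C" by (rule bounded_subset[OF bounded_cball])
  moreover have "blinfun_apply E v + (\<Sum>i=1..n. a i *\<^sub>R y i) \<in> C" if vD: "v \<in> D" for v
  proof -
    obtain x where v: "v = (\<Sum>i=1..n. a i *\<^sub>R x i)" and x: "\<forall>i\<in>{1..n}. x i \<in> T i"
      using vD unfolding D_def by blast
    have "blinfun_apply E v + (\<Sum>i=1..n. a i *\<^sub>R y i) = (\<Sum>i=1..n. a i *\<^sub>R (blinfun_apply E (x i) + y i))"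
      by (simp add: v blinfun.sum_right blinfun.scaleR_right scaleR_add_right sum.distrib)
    moreover have "\<forall>i\<in>{1..n}. blinfun_apply E (x i) + y i \<in> S i" using TS x by blast
    ultimately show ?thesis
      unfolding C_eq mem_Collect_eq by (intro exI[of _ "\<lambda>i. blinfun_apply E (x i) + y i"] conjI)
  qed
  ultimately have "diameter D \<le> diameter C" by (rule diameter_le_of_translate)
  then have "diameter D < \<epsilon>" using C(2) by simp
  moreover have "convex_combination_of_slices D"
    unfolding convex_combination_of_slices_def
    by (intro exI[of _ n] exI[of _ a] exI[of _ T] conjI n a1 ballI D_def) (use S T in auto)
  ultimately show "\<exists>C::'x set. convex_combination_of_slices C \<and> diameter C < \<epsilon>"
    by blast
qed

lemma BHP_summand:
  assumes "BHP TYPE('z)"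
  shows "BHP TYPE('x)"
  unfolding BHP_def
proof (intro allI impI)
  fix \<epsilon> :: real assume "\<epsilon> > 0"
  then obtain W :: "'z set" where W: "openin (subtopology weak_topology (cball 0 1)) W"
      "W \<noteq> {}" "diameter W < \<epsilon>"
    using assms unfolding BHP_def by blast
  then obtain U where U: "openin weak_topology U" and WU: "W = U \<inter> cball 0 1"
    by (auto simp: openin_subtopology)
  obtain z where z: "z \<in> W" using W(2) by blast
  define V where "V = {x. blinfun_apply E x + blinfun_apply Q z \<in> U} \<inter> cball 0 1"
  have "openin (subtopology weak_topology (cball 0 1)) V"
    unfolding V_def openin_subtopology
    using openin_preimage_UNIV[OF continuous_map_weak_affine topspace_weak_topology U] by blast
  moreover have "blinfun_apply R z \<in> V"
    using z norm_R_le[of z] by (simp add: V_def WU decompose)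
  moreover have "diameter V \<le> diameter W"
  proof (rule diameter_le_of_translate)
    show "bounded W" unfolding WU by (rule bounded_subset[OF bounded_cball]) auto
    show "blinfun_apply E x + blinfun_apply Q z \<in> W" if "x \<in> V" for x
      using that z norm_E_add_Q_le_1[of x z] by (simp add: V_def WU)
  qed
  ultimately show "\<exists>W::'x set. openin (subtopology weak_topology (cball 0 1)) W \<and> W \<noteq> {} \<and> diameter W < \<epsilon>"
    using W(3) by (intro exI[of _ V]) auto
qed

text \<open>
  This inequality and \<open>dual_norm_le\<close> say that \<open>Z\<^sup>* = X\<^sup>* \<oplus>\<^sub>1 Y\<^sup>*\<close>. Here the maximum norm matters: nearly
  norming vectors for the two components can be added without leaving the unit ball.
\<close>

lemma dual_norm_split:
  fixes f :: "'z \<Rightarrow>\<^sub>L real"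
  shows "norm (f o\<^sub>L E) + norm (f o\<^sub>L Q) \<le> norm f"
proof (rule ccontr)
  assume less: "\<not> ?thesis"
  define d where "d = (norm (f o\<^sub>L E) + norm (f o\<^sub>L Q) - norm f) / 2"
  have "d > 0" using less by (simp add: d_def)
  then obtain x where x: "norm x \<le> 1" "blinfun_apply (f o\<^sub>L E) x > norm (f o\<^sub>L E) - d"
    by (metis functional_exceeds_on_ball diff_less_eq less_add_same_cancel1)
  obtain z where z: "norm z \<le> 1" "blinfun_apply (f o\<^sub>L Q) z > norm (f o\<^sub>L Q) - d"
    using \<open>d > 0\<close> by (metis functional_exceeds_on_ball diff_less_eq less_add_same_cancel1)
  have "norm f < blinfun_apply f (blinfun_apply E x + blinfun_apply Q z)"
    using x(2) z(2) by (simp add: blinfun.add_right d_def field_simps)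
  also have "\<dots> \<le> norm f * norm (blinfun_apply E x + blinfun_apply Q z)"
    using norm_blinfun[of f "blinfun_apply E x + blinfun_apply Q z"] by simp
  also have "\<dots> \<le> norm f"
    using norm_E_add_Q_le_1[OF x(1) z(1)] by (simp add: mult_left_le)
  finally show False by simp
qed

lemma dual_norm_le:
  fixes f :: "'z \<Rightarrow>\<^sub>L real"
  shows "norm f \<le> norm (f o\<^sub>L E) + norm (f o\<^sub>L Q)"
proof (rule norm_blinfun_bound)
  fix z
  have "blinfun_apply f z = blinfun_apply (f o\<^sub>L E) (blinfun_apply R z) + blinfun_apply (f o\<^sub>L Q) z"
    using arg_cong[OF decompose[of z], of "blinfun_apply f"] by (simp add: blinfun.add_right)
  then have "norm (blinfun_apply f z) \<le>
      norm (blinfun_apply (f o\<^sub>L E) (blinfun_apply R z)) + norm (blinfun_apply (f o\<^sub>L Q) z)"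
    using norm_triangle_ineq by metis
  also have "\<dots> \<le> norm (f o\<^sub>L E) * norm z + norm (f o\<^sub>L Q) * norm z"
    by (intro add_mono norm_blinfun order_trans[OF norm_blinfun] mult_left_mono norm_R_le) simp
  finally show "norm (blinfun_apply f z) \<le> (norm (f o\<^sub>L E) + norm (f o\<^sub>L Q)) * norm z"
    by (simp add: distrib_right)
qed simp

text \<open>
  Pull back a small \<open>w\<^sup>*\<close>-open \<open>U\<close> that contains some \<open>h\<close> of norm above \<open>1 - \<delta>\<close>. The norm of the
  \<open>X\<^sup>*\<close>-component must also be kept above \<open>1 - \<delta>\<close> by a \<open>w\<^sup>*\<close>-open condition; evaluation at one \<open>x\<close>
  in \<open>B\<^sub>X\<close> with \<open>h x > 1 - \<delta>\<close> suffices. Then the \<open>X\<^sup>*\<close>-components contribute \<open>\<delta>\<close> to the diameter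
  and the \<open>Y\<^sup>*\<close>-components \<open>2 * \<delta>\<close>.
\<close>

lemma dual_wstar_BHP_summand:
  assumes "dual_wstar_BHP TYPE('x)" and ne: "\<exists>x::'x. x \<noteq> 0"
  shows "dual_wstar_BHP TYPE('z)"
  unfolding dual_wstar_BHP_def
proof (intro allI impI)
  fix \<epsilon> :: real assume "\<epsilon> > 0"
  define \<delta> where "\<delta> = min 1 (\<epsilon> / 4)"
  have \<delta>: "0 < \<delta>" "\<delta> \<le> 1" "3 * \<delta> < \<epsilon>" using \<open>\<epsilon> > 0\<close> by (auto simp: \<delta>_def min_def)
  obtain U and h :: "'x \<Rightarrow>\<^sub>L real"
    where U: "openin weak_star_topology U" and h: "h \<in> U" "norm h \<le> 1" "norm h > 1 - \<delta>"
      and small: "\<And>f g. \<lbrakk>f \<in> U; g \<in> U; norm f \<le> 1; norm g \<le> 1\<rbrakk> \<Longrightarrow> norm (f - g) \<le> \<delta>"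
    using dual_wstar_BHP_near_sphere[OF assms \<delta>(1,2)] by blast
  obtain x where x: "norm x \<le> 1" "blinfun_apply h x > 1 - \<delta>"
    by (rule functional_exceeds_on_ball[OF h(3)])
  define V :: "('z \<Rightarrow>\<^sub>L real) set" where
    "V = {f. f o\<^sub>L E \<in> U} \<inter> {f. 1 - \<delta> < blinfun_apply f (blinfun_apply E x)}"
  define W where "W = V \<inter> cball 0 1"
  have "continuous_map weak_star_topology weak_star_topology (\<lambda>f :: 'z \<Rightarrow>\<^sub>L real. f o\<^sub>L E)"
    unfolding continuous_on_strong_operator_topo_iff_coordinatewise
    by (auto intro: strong_operator_topology_continuous_evaluation)
  then have "openin weak_star_topology V"
    unfolding V_def
    by (intro openin_Int openin_weak_star_greater openin_preimage_UNIV[OF _ _ U])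
      (simp_all add: strong_operator_topology_topspace)
  then have "openin (subtopology weak_star_topology (cball 0 1)) W"
    unfolding W_def openin_subtopology by blast
  moreover have "h o\<^sub>L R \<in> W"
  proof -
    have "h o\<^sub>L R o\<^sub>L E = h" by (rule blinfun_eqI) simp
    moreover have "norm (h o\<^sub>L R) \<le> 1"
    proof (rule norm_blinfun_bound)
      show "norm (blinfun_apply (h o\<^sub>L R) z) \<le> 1 * norm z" for z
        using norm_blinfun[of h "blinfun_apply R z"] mult_mono[OF h(2) norm_R_le[of z]] by simp
    qed simp
    ultimately show ?thesis using h(1) x(2) by (simp add: W_def V_def)
  qed
  moreover have "diameter W \<le> 3 * \<delta>"
  proof (rule diameter_le)
    have part: "f o\<^sub>L E \<in> U \<and> norm (f o\<^sub>L E) \<le> 1 \<and> norm (f o\<^sub>L Q) \<le> \<delta>" if "f \<in> W" for f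
    proof -
      have f: "f o\<^sub>L E \<in> U" "1 - \<delta> < blinfun_apply (f o\<^sub>L E) x" "norm f \<le> 1"
        using that by (auto simp: W_def V_def)
      have "blinfun_apply (f o\<^sub>L E) x \<le> norm (f o\<^sub>L E) * norm x"
        using norm_blinfun[of "f o\<^sub>L E" x] by simp
      also have "\<dots> \<le> norm (f o\<^sub>L E)" using x(1) by (simp add: mult_left_le)
      finally have lower: "1 - \<delta> < norm (f o\<^sub>L E)" using f(2) by simp
      have "norm (f o\<^sub>L E) + norm (f o\<^sub>L Q) \<le> 1" using dual_norm_split[of f] f(3) by simp
      with lower have "norm (f o\<^sub>L E) \<le> 1" "norm (f o\<^sub>L Q) \<le> \<delta>"
        using norm_ge_zero[of "f o\<^sub>L Q"] by linarith+
      with f(1) show ?thesis by blast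
    qed
    fix f g assume "f \<in> W" "g \<in> W"
    note fg = part[OF \<open>f \<in> W\<close>] part[OF \<open>g \<in> W\<close>]
    have E: "(f - g) o\<^sub>L E = (f o\<^sub>L E) - (g o\<^sub>L E)" and Q: "(f - g) o\<^sub>L Q = (f o\<^sub>L Q) - (g o\<^sub>L Q)"
      by (auto intro!: blinfun_eqI simp: blinfun.diff_left)
    have "norm (f - g) \<le> norm ((f o\<^sub>L E) - (g o\<^sub>L E)) + norm ((f o\<^sub>L Q) - (g o\<^sub>L Q))"
      using dual_norm_le[of "f - g"] unfolding E Q .
    also have "\<dots> \<le> \<delta> + (\<delta> + \<delta>)"
      using small[of "f o\<^sub>L E" "g o\<^sub>L E"] norm_triangle_ineq4[of "f o\<^sub>L Q" "g o\<^sub>L Q"] fg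
      by (intro add_mono) auto
    finally show "norm (f - g) \<le> 3 * \<delta>" by simp
  qed (use \<delta>(1) in simp)
  ultimately show "\<exists>W::('z \<Rightarrow>\<^sub>L real) set.
      openin (subtopology weak_star_topology (cball 0 1)) W \<and> W \<noteq> {} \<and> diameter W < \<epsilon>"
    using \<delta>(3) by (intro exI[of _ W]) auto
qed

end

section \<open>An isolated point splits off a summand\<close>

lemma continuous_point_mass:
  fixes k0 :: "'k::t1_space"
  assumes "k0 isolated_in UNIV"
  shows "continuous_on UNIV (\<lambda>k. if k = k0 then x else (y::'b::topological_space))"
proof -
  have op: "open {k0}" using assms by (auto simp: isolated_in_def)
  have "continuous_on ({k0} \<union> - {k0}) (\<lambda>k. if k = k0 then x else y)"
    by (rule continuous_on_cases) (use op in auto)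
  then show ?thesis by (simp add: Un_commute)
qed

lemma max_norm_summand_at_isolated_point:
  fixes k0 :: "'k::t1_space"
  assumes k0: "k0 isolated_in UNIV"
  shows "\<exists>(E :: 'x::real_normed_vector \<Rightarrow>\<^sub>L ('k \<Rightarrow>\<^sub>C 'x)) R. max_norm_summand E R"
proof -
  define e :: "'x \<Rightarrow> 'k \<Rightarrow>\<^sub>C 'x" where "e x = Bcontfun (\<lambda>k. if k = k0 then x else 0)" for x
  have e: "apply_bcontfun (e x) k = (if k = k0 then x else 0)" for x k
    unfolding e_def
    by (subst Bcontfun_inverse) (auto intro!: bcontfun_normI[of _ "norm x"] continuous_point_mass[OF k0])
  have "bounded_linear e"
  proof (rule bounded_linear_intro[where K = 1])
    show "norm (e x) \<le> norm x * 1" for x by (rule norm_bound) (simp add: e)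
  qed (auto intro!: bcontfun_eqI simp: e)
  then have E: "blinfun_apply (Blinfun e) = e" by (rule bounded_linear_Blinfun_apply)
  define r :: "('k \<Rightarrow>\<^sub>C 'x) \<Rightarrow> 'x" where "r z = apply_bcontfun z k0" for z
  have "bounded_linear r"
    by (rule bounded_linear_intro[where K = 1]) (auto simp: r_def norm_bounded)
  then have R: "blinfun_apply (Blinfun r) = r" by (rule bounded_linear_Blinfun_apply)
  have "max_norm_summand (Blinfun e) (Blinfun r)"
  proof
    show "blinfun_apply (Blinfun r) (blinfun_apply (Blinfun e) x) = x" for x
      by (simp add: E R r_def e)
    fix z :: "'k \<Rightarrow>\<^sub>C 'x"
    have "norm z = max (norm (r z)) (norm (z - e (r z)))"
    proof (rule antisym)
      show "norm z \<le> max (norm (r z)) (norm (z - e (r z)))"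
      proof (rule norm_bound)
        fix k
        show "norm (apply_bcontfun z k) \<le> max (norm (r z)) (norm (z - e (r z)))"
          using norm_bounded[of "z - e (r z)" k] by (cases "k = k0") (auto simp: e r_def)
      qed
      have "norm (z - e (r z)) \<le> norm z"
        by (rule norm_bound) (auto simp: e r_def norm_bounded)
      then show "max (norm (r z)) (norm (z - e (r z))) \<le> norm z"
        by (simp add: r_def norm_bounded)
    qed
    then show "norm z = max (norm (blinfun_apply (Blinfun r) z))
        (norm (z - blinfun_apply (Blinfun e) (blinfun_apply (Blinfun r) z)))"
      by (simp add: E R)
  qed
  then show ?thesis by blast
qed

theorem proposition2p8:
  assumes "compact (UNIV :: 'k::t2_space set)"
    and "\<exists>k::'k. k isolated_in UNIV"
    and "\<exists>x::'x::banach. x \<noteq> 0"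
  shows "(BSCSP TYPE('k \<Rightarrow>\<^sub>C 'x) \<longrightarrow> BSCSP TYPE('x)) \<and>
         (BHP TYPE('k \<Rightarrow>\<^sub>C 'x) \<longrightarrow> BHP TYPE('x)) \<and>
         (BDP TYPE('k \<Rightarrow>\<^sub>C 'x) \<longrightarrow> BDP TYPE('x)) \<and>
         (dual_wstar_BHP TYPE('x) \<longrightarrow> dual_wstar_BHP TYPE('k \<Rightarrow>\<^sub>C 'x))"
proof -
  obtain k0 :: 'k where "k0 isolated_in UNIV" using assms(2) by blast
  then obtain E :: "'x \<Rightarrow>\<^sub>L ('k \<Rightarrow>\<^sub>C 'x)" and R where "max_norm_summand E R"
    using max_norm_summand_at_isolated_point by metis
  then interpret max_norm_summand E R .
  show ?thesis
    using BSCSP_summand BHP_summand BDP_summand dual_wstar_BHP_summand assms(3) by blast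
qed

end
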